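(* Let $k\ge 1$ and let $G$ be a finite $k$-uniform hypergraph on $N$ vertices (qubits) with edges $I_1,\dots,I_M$. Let $H=\sum_{m=1}^{M}\Pi^{I_m}_{\phi_m}$ be an instance of random $k$-QSAT over $G$. Then there is an integer $D$, depending only on $G$, such that $\dim(\ker(H))=D$ with probability $1$ with respect to the random choice of the projectors on the edges of $G$.
   Context: Each vertex of $G$ carries a qubit $\mathbb{C}^2$, and the full Hilbert space is $(\mathbb{C}^2)^{\otimes N}$. For each edge $I_m$ (a set of $k$ distinct vertices), a unit vector $|\phi_m\rangle$ is chosen in the $2^k$-dimensional Hilbert space of the $k$ qubits in $I_m$, independently for different $m$ and uniformly (Haar measure) on the unit sphere. $\Pi^{I_m}_{\phi_m}$ denotes the operator $|\phi_m\rangle\langle\phi_m|$ acting on the qubits in $I_m$, tensored with the identity on the remaining qubits. An instance of random $k$-QSAT over $G$ is the random positive semidefinite operator $H=\sum_{m=1}^M\Pi^{I_m}_{\phi_m}$ on $(\mathbb{C}^2)^{\otimes N}$; $\ker(H)$ is the space of zero-energy (satisfying) states. *)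

theory Defs
  imports "HOL-Probability.Probability"
begin

text \<open>
  A vector of the complex Hilbert space with finite orthonormal basis \<open>B\<close> is its family of
  coordinates, an extensional function \<open>\<psi> \<in> B \<rightarrow>\<^sub>E UNIV\<close>.
\<close>

definition ket_norm :: "'b set \<Rightarrow> ('b \<Rightarrow> complex) \<Rightarrow> real" where
  "ket_norm B \<psi> = L2_set (\<lambda>b. cmod (\<psi> b)) B"

definition normalise :: "'b set \<Rightarrow> ('b \<Rightarrow> complex) \<Rightarrow> 'b \<Rightarrow> complex" where
  "normalise B \<psi> = (\<lambda>b\<in>B. \<psi> b / of_real (ket_norm B \<psi>))"

definition ket_space :: "'b set \<Rightarrow> ('b \<Rightarrow> complex) measure" where
  "ket_space B = (\<Pi>\<^sub>M b\<in>B. lborel)"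

definition ket_ball :: "'b set \<Rightarrow> ('b \<Rightarrow> complex) set" where
  "ket_ball B = {\<psi> \<in> B \<rightarrow>\<^sub>E UNIV. ket_norm B \<psi> \<le> 1}"

text \<open>
  The uniform probability measure on the unit sphere: the law of \<open>\<psi> / \<parallel>\<psi>\<parallel>\<close> for \<open>\<psi>\<close>
  Lebesgue-distributed in the unit ball.  It is a probability measure carried by the sphere
  and invariant under all unitaries (lemmas \<open>prob_space_haar_sphere\<close>, \<open>AE_haar_sphere_norm\<close>,
  \<open>haar_sphere_unitary_invariant\<close> below), which is what characterises the Haar measure.
\<close>

definition haar_sphere :: "'b set \<Rightarrow> ('b \<Rightarrow> complex) measure" where
  "haar_sphere B =
     distr (uniform_measure (ket_space B) (ket_ball B)) (\<Pi>\<^sub>M b\<in>B. borel) (normalise B)"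

lemma sets_ket_space: "sets (ket_space B) = sets (\<Pi>\<^sub>M b\<in>B. borel)"
  unfolding ket_space_def by (rule sets_PiM_cong) auto

lemma space_ket_space: "space (ket_space B) = B \<rightarrow>\<^sub>E UNIV"
  by (simp add: ket_space_def space_PiM)

lemma measurable_ket_space [measurable_cong]:
  "sets (ket_space B) = sets (\<Pi>\<^sub>M b\<in>B. lborel)"
  by (simp add: ket_space_def)

lemma measurable_ket_norm [measurable]: "ket_norm B \<in> borel_measurable (ket_space B)"
  unfolding ket_norm_def[abs_def] L2_set_def ket_space_def by measurable

lemma measurable_normalise [measurable]: "normalise B \<in> ket_space B \<rightarrow>\<^sub>M (\<Pi>\<^sub>M b\<in>B. borel)"
proof -
  have [measurable]: "ket_norm B \<in> borel_measurable (\<Pi>\<^sub>M b\<in>B. lborel)"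
    using measurable_ket_norm[of B] by (simp add: ket_space_def)
  show ?thesis
    unfolding normalise_def[abs_def] ket_space_def by measurable
qed

lemma sets_ket_ball [measurable]: "ket_ball B \<in> sets (ket_space B)"
proof -
  have "ket_ball B = {\<psi> \<in> space (ket_space B). ket_norm B \<psi> \<le> 1}"
    by (auto simp: ket_ball_def space_ket_space)
  then show ?thesis by simp
qed

lemma ket_space_affine:
  fixes s :: real
  assumes "finite B" and s: "\<bar>s\<bar> = 1"
  shows "distr (ket_space B) (ket_space B) (\<lambda>\<psi>. \<lambda>b\<in>B. v b + s *\<^sub>R \<psi> b) = ket_space B"
proof -
  interpret product_sigma_finite "\<lambda>_::'a. lborel :: complex measure" ..
  define T where "T = (\<lambda>\<psi>. \<lambda>b\<in>B. v b + s *\<^sub>R (\<psi> b :: complex))"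
  have T [measurable]: "T \<in> ket_space B \<rightarrow>\<^sub>M ket_space B"
    unfolding T_def ket_space_def by measurable
  have "distr (ket_space B) (ket_space B) T = Pi\<^sub>M B (\<lambda>_. lborel)"
  proof (rule PiM_eqI)
    fix A :: "'a \<Rightarrow> complex set" assume A: "\<And>i. i \<in> B \<Longrightarrow> A i \<in> sets lborel"
    have eq: "emeasure lborel ((\<lambda>z. v b + s *\<^sub>R z) -` A b) = emeasure lborel (A b)" if "b \<in> B" for b
    proof -
      have "(lborel :: complex measure) = density (distr lborel borel (\<lambda>z. v b + s *\<^sub>R z)) (\<lambda>_. \<bar>s\<bar> ^ DIM(complex))"
        by (rule lborel_affine) (use s in auto)
      then have l: "(lborel :: complex measure) = distr lborel borel (\<lambda>z. v b + s *\<^sub>R z)"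
        using s by (simp add: density_1)
      show ?thesis
        by (subst (2) l, subst emeasure_distr) (use A[OF that] in auto)
    qed
    have m: "(\<lambda>z. v b + s *\<^sub>R z) -` A b \<in> sets lborel" if "b \<in> B" for b
      using A[OF that] measurable_sets[of "\<lambda>z. v b + s *\<^sub>R z" lborel borel "A b"] by simp
    have "Pi\<^sub>E B A \<in> sets (ket_space B)"
      unfolding ket_space_def using A assms(1) by (auto intro!: sets_PiM_I_finite)
    then have "emeasure (distr (ket_space B) (ket_space B) T) (Pi\<^sub>E B A)
        = emeasure (ket_space B) (T -` Pi\<^sub>E B A \<inter> space (ket_space B))"
      by (subst emeasure_distr) auto
    also have "T -` Pi\<^sub>E B A \<inter> space (ket_space B) = Pi\<^sub>E B (\<lambda>b. (\<lambda>z. v b + s *\<^sub>R z) -` A b)"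
      by (auto simp: T_def space_ket_space PiE_iff)
    also have "emeasure (ket_space B) \<dots> = (\<Prod>b\<in>B. emeasure lborel (A b))"
      unfolding ket_space_def using m by (subst emeasure_PiM) (auto simp: assms eq)
    finally show "emeasure (distr (ket_space B) (ket_space B) T) (Pi\<^sub>E B A)
        = (\<Prod>b\<in>B. emeasure lborel (A b))" .
  qed (simp_all add: assms ket_space_def)
  then show ?thesis by (simp add: T_def ket_space_def)
qed

lemma nn_integral_ket_space_affine:
  fixes s :: real
  assumes "finite B" "\<bar>s\<bar> = 1" and f: "f \<in> borel_measurable (ket_space B)"
  shows "(\<integral>\<^sup>+\<psi>. f (\<lambda>b\<in>B. v b + s *\<^sub>R \<psi> b) \<partial>ket_space B) = (\<integral>\<^sup>+\<psi>. f \<psi> \<partial>ket_space B)"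
proof -
  have "(\<lambda>\<psi>. \<lambda>b\<in>B. v b + s *\<^sub>R \<psi> b) \<in> ket_space B \<rightarrow>\<^sub>M ket_space B"
    unfolding ket_space_def by measurable
  from nn_integral_distr[OF this, of f] f ket_space_affine[OF assms(1,2)]
  show ?thesis by simp
qed

lemma emeasure_ket_ball:
  assumes "finite B"
  shows "emeasure (ket_space B) (ket_ball B) \<noteq> 0" "emeasure (ket_space B) (ket_ball B) \<noteq> \<infinity>"
proof -
  interpret product_sigma_finite "\<lambda>_::'a. lborel :: complex measure" ..
  define r where "r = 1 / (real (card B) + 1)"
  have r: "r > 0" by (simp add: r_def)
  have E: "emeasure (ket_space B) (Pi\<^sub>E B (\<lambda>_. cball 0 t)) = (\<Prod>b\<in>B. emeasure lborel (cball (0::complex) t))" for t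
    unfolding ket_space_def by (subst emeasure_PiM) (auto simp: assms)
  have M: "Pi\<^sub>E B (\<lambda>_. cball 0 t) \<in> sets (ket_space B)" for t
    unfolding ket_space_def by (auto intro!: sets_PiM_I_finite simp: assms)
  have pos: "emeasure lborel (cball (0::complex) r) \<noteq> 0"
    using r by (simp add: emeasure_cball ennreal_eq_0_iff not_le)
  have "Pi\<^sub>E B (\<lambda>_. cball 0 r) \<subseteq> ket_ball B"
  proof
    fix \<psi> :: "'a \<Rightarrow> complex" assume \<psi>: "\<psi> \<in> Pi\<^sub>E B (\<lambda>_. cball 0 r)"
    have "ket_norm B \<psi> \<le> (\<Sum>b\<in>B. cmod (\<psi> b))"
      unfolding ket_norm_def by (rule L2_set_le_sum) auto
    also have "\<dots> \<le> (\<Sum>b\<in>B. r)" by (rule sum_mono) (use \<psi> in auto)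
    also have "\<dots> \<le> 1" by (simp add: r_def field_simps)
    finally show "\<psi> \<in> ket_ball B" using \<psi> by (auto simp: ket_ball_def PiE_iff)
  qed
  then have "emeasure (ket_space B) (Pi\<^sub>E B (\<lambda>_. cball 0 r)) \<le> emeasure (ket_space B) (ket_ball B)"
    by (rule emeasure_mono) simp
  moreover have "emeasure (ket_space B) (Pi\<^sub>E B (\<lambda>_. cball 0 r)) \<noteq> 0"
    using pos assms by (simp add: E)
  ultimately show "emeasure (ket_space B) (ket_ball B) \<noteq> 0" by (auto simp flip: zero_less_iff_neq_zero)
  have "ket_ball B \<subseteq> Pi\<^sub>E B (\<lambda>_. cball 0 1)"
  proof
    fix \<psi> :: "'a \<Rightarrow> complex" assume \<psi>: "\<psi> \<in> ket_ball B"
    have "cmod (\<psi> b) \<le> 1" if "b \<in> B" for b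
      using member_le_L2_set[OF assms that, of "\<lambda>b. cmod (\<psi> b)"] \<psi>
      by (auto simp: ket_ball_def ket_norm_def)
    then show "\<psi> \<in> Pi\<^sub>E B (\<lambda>_. cball 0 1)" using \<psi> by (auto simp: ket_ball_def PiE_iff)
  qed
  then have "emeasure (ket_space B) (ket_ball B) \<le> emeasure (ket_space B) (Pi\<^sub>E B (\<lambda>_. cball 0 1))"
    by (rule emeasure_mono) (rule M)
  also have "\<dots> < \<infinity>" unfolding E
    by (simp add: emeasure_cball ennreal_power[symmetric] power_less_top_ennreal)
  finally show "emeasure (ket_space B) (ket_ball B) \<noteq> \<infinity>" by simp
qed

lemma prob_space_haar_sphere:
  assumes "finite B"
  shows "prob_space (haar_sphere B)"
  unfolding haar_sphere_def
  by (intro prob_space.prob_space_distr prob_space_uniform_measure emeasure_ket_ball assms)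
     (simp add: measurable_normalise)

lemma ket_norm_normalise:
  assumes "ket_norm B \<psi> \<noteq> 0"
  shows "ket_norm B (normalise B \<psi>) = 1"
proof -
  have p: "ket_norm B \<psi> > 0" using assms by (simp add: ket_norm_def order_less_le)
  have "ket_norm B (normalise B \<psi>) = L2_set (\<lambda>b. cmod (\<psi> b) * (1 / ket_norm B \<psi>)) B"
    unfolding ket_norm_def[of B "normalise B \<psi>"]
    by (rule L2_set_cong) (use p in \<open>auto simp: normalise_def norm_divide\<close>)
  also have "\<dots> = ket_norm B \<psi> * (1 / ket_norm B \<psi>)"
    unfolding ket_norm_def[of B \<psi>] by (rule L2_set_left_distrib[symmetric]) simp
  finally show ?thesis using p by simp
qed

lemma AE_haar_sphere_norm:
  assumes "finite B" "B \<noteq> {}"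
  shows "AE \<psi> in haar_sphere B. ket_norm B \<psi> = 1"
proof -
  interpret product_sigma_finite "\<lambda>_::'a. lborel :: complex measure" ..
  have "emeasure (ket_space B) (Pi\<^sub>E B (\<lambda>_. {0})) = (\<Prod>b\<in>B. emeasure lborel {0::complex})"
    unfolding ket_space_def by (subst emeasure_PiM) (auto simp: assms)
  also have "\<dots> = 0" using assms by (simp add: card_gt_0_iff)
  finally have "emeasure (ket_space B) (Pi\<^sub>E B (\<lambda>_. {0})) = 0" .
  moreover have "Pi\<^sub>E B (\<lambda>_. {0}) \<in> sets (ket_space B)"
    unfolding ket_space_def by (rule sets_PiM_I_finite) (simp_all add: assms)
  ultimately have "Pi\<^sub>E B (\<lambda>_. {0}) \<in> null_sets (ket_space B)" by blast
  then have "AE \<psi> in ket_space B. \<psi> \<notin> Pi\<^sub>E B (\<lambda>_. {0})" by (rule AE_not_in)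
  then have "AE \<psi> in ket_space B. ket_norm B (normalise B \<psi>) = 1"
  proof (rule AE_mp, intro AE_I2 impI)
    fix \<psi> assume "\<psi> \<in> space (ket_space B)" "\<psi> \<notin> Pi\<^sub>E B (\<lambda>_. {0})"
    then have "\<not> (\<forall>b\<in>B. \<psi> b = 0)"
      unfolding space_ket_space PiE_iff by blast
    then have "ket_norm B \<psi> \<noteq> 0"
      by (simp add: ket_norm_def L2_set_eq_0_iff[OF assms(1)])
    then show "ket_norm B (normalise B \<psi>) = 1" by (rule ket_norm_normalise)
  qed
  then have *: "AE \<psi> in uniform_measure (ket_space B) (ket_ball B). ket_norm B (normalise B \<psi>) = 1"
    by (intro AE_uniform_measureI sets_ket_ball) auto
  have [measurable]: "ket_norm B \<in> borel_measurable (\<Pi>\<^sub>M b\<in>B. borel)"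
    using measurable_ket_norm by (simp cong: measurable_cong_sets add: measurable_cong_sets[OF sets_ket_space refl])
  show ?thesis unfolding haar_sphere_def
    by (subst AE_distr_iff) (use * in \<open>auto simp: measurable_normalise\<close>)
qed

definition unitary_on :: "'b set \<Rightarrow> ('b \<Rightarrow> 'b \<Rightarrow> complex) \<Rightarrow> bool" where
  "unitary_on B U \<longleftrightarrow>
     (\<forall>a\<in>B. \<forall>b\<in>B. (\<Sum>c\<in>B. cnj (U c a) * U c b) = (if a = b then 1 else 0)) \<and>
     (\<forall>a\<in>B. \<forall>b\<in>B. (\<Sum>c\<in>B. U a c * cnj (U b c)) = (if a = b then 1 else 0))"

definition op_apply :: "'b set \<Rightarrow> ('b \<Rightarrow> 'b \<Rightarrow> complex) \<Rightarrow> ('b \<Rightarrow> complex) \<Rightarrow> 'b \<Rightarrow> complex" where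
  "op_apply B U \<psi> = (\<lambda>a\<in>B. \<Sum>b\<in>B. U a b * \<psi> b)"

lemma op_apply_inverse:
  assumes "finite B" "unitary_on B U" "\<psi> \<in> B \<rightarrow>\<^sub>E UNIV"
  shows "op_apply B U (op_apply B (\<lambda>a b. cnj (U b a)) \<psi>) = \<psi>"
proof
  fix a
  show "op_apply B U (op_apply B (\<lambda>a b. cnj (U b a)) \<psi>) a = \<psi> a"
  proof (cases "a \<in> B")
    case True
    have "op_apply B U (op_apply B (\<lambda>a b. cnj (U b a)) \<psi>) a
        = (\<Sum>b\<in>B. \<Sum>c\<in>B. U a b * cnj (U c b) * \<psi> c)"
      using True by (simp add: op_apply_def sum_distrib_left mult.assoc)
    also have "\<dots> = (\<Sum>c\<in>B. (\<Sum>b\<in>B. U a b * cnj (U c b)) * \<psi> c)"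
      by (subst sum.swap) (simp add: sum_distrib_right)
    also have "\<dots> = (\<Sum>c\<in>B. if a = c then \<psi> c else 0)"
      using assms(2) True by (intro sum.cong) (auto simp: unitary_on_def)
    also have "\<dots> = \<psi> a" using True assms(1) by simp
    finally show ?thesis .
  next
    case False
    then show ?thesis using assms(3) by (auto simp: op_apply_def PiE_iff extensional_def)
  qed
qed

lemma ket_norm_op_apply:
  assumes "finite B" "unitary_on B U"
  shows "ket_norm B (op_apply B U \<psi>) = ket_norm B \<psi>"
proof -
  have "complex_of_real (\<Sum>a\<in>B. (cmod (op_apply B U \<psi> a))\<^sup>2)
      = (\<Sum>a\<in>B. (\<Sum>b\<in>B. U a b * \<psi> b) * cnj (\<Sum>c\<in>B. U a c * \<psi> c))"
    unfolding of_real_sum op_apply_def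
    by (intro sum.cong refl) (simp only: complex_norm_square restrict_apply')
  also have "\<dots> = (\<Sum>a\<in>B. \<Sum>c\<in>B. \<Sum>b\<in>B. (cnj (U a c) * U a b) * (\<psi> b * cnj (\<psi> c)))"
    by (simp add: sum_distrib_left sum_distrib_right mult_ac)
  also have "\<dots> = (\<Sum>c\<in>B. \<Sum>a\<in>B. \<Sum>b\<in>B. (cnj (U a c) * U a b) * (\<psi> b * cnj (\<psi> c)))"
    by (rule sum.swap)
  also have "\<dots> = (\<Sum>c\<in>B. \<Sum>b\<in>B. (\<Sum>a\<in>B. cnj (U a c) * U a b) * (\<psi> b * cnj (\<psi> c)))"
    unfolding sum_distrib_right by (rule sum.cong[OF refl], rule sum.swap)
  also have "\<dots> = (\<Sum>c\<in>B. \<Sum>b\<in>B. if c = b then \<psi> b * cnj (\<psi> c) else 0)"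
    using assms(2) by (intro sum.cong refl) (auto simp: unitary_on_def)
  also have "\<dots> = (\<Sum>a\<in>B. \<psi> a * cnj (\<psi> a))"
    using assms(1) by simp
  also have "\<dots> = complex_of_real (\<Sum>a\<in>B. (cmod (\<psi> a))\<^sup>2)"
    by (simp only: of_real_sum complex_norm_square)
  finally have "(\<Sum>a\<in>B. (cmod (op_apply B U \<psi> a))\<^sup>2) = (\<Sum>a\<in>B. (cmod (\<psi> a))\<^sup>2)"
    by (simp only: of_real_eq_iff)
  then show ?thesis by (simp add: ket_norm_def L2_set_def)
qed

lemma measurable_op_apply [measurable]: "op_apply B U \<in> ket_space B \<rightarrow>\<^sub>M ket_space B"
  unfolding op_apply_def[abs_def] ket_space_def by measurable

lemma op_apply_ball_iff:
  assumes "finite B" "unitary_on B U" "\<psi> \<in> B \<rightarrow>\<^sub>E UNIV"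
  shows "op_apply B U \<psi> \<in> ket_ball B \<longleftrightarrow> \<psi> \<in> ket_ball B"
  using assms by (simp add: ket_ball_def ket_norm_op_apply) (simp add: op_apply_def)

text \<open>
  The image measure is again translation invariant and gives the unit ball the same mass, so
  integrating over \<open>{(\<psi>, \<eta>). \<psi> \<in> C \<and> \<psi> - \<eta> \<in> ball}\<close> in both orders shows that it agrees with
  Lebesgue measure.
\<close>

lemma ket_space_unitary_invariant:
  assumes B: "finite B" and U: "unitary_on B U"
  shows "distr (ket_space B) (ket_space B) (op_apply B U) = ket_space B"
proof (rule measure_eqI)
  interpret product_sigma_finite "\<lambda>_::'a. lborel :: complex measure" ..
  interpret finite_product_sigma_finite "\<lambda>_::'a. lborel :: complex measure" B by standard fact
  interpret P: pair_sigma_finite "ket_space B" "ket_space B"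
    unfolding ket_space_def ..
  fix C assume "C \<in> sets (distr (ket_space B) (ket_space B) (op_apply B U))"
  then have C [measurable]: "C \<in> sets (ket_space B)" by simp
  let ?L = "ket_space B" and ?K = "ket_ball B" and ?T = "op_apply B U"
  let ?\<kappa> = "emeasure ?L ?K"
  have add_meas [measurable]: "(\<lambda>p. \<lambda>b\<in>B. fst p b + s *\<^sub>R snd p b) \<in> ?L \<Otimes>\<^sub>M ?L \<rightarrow>\<^sub>M ?L" for s :: real
    unfolding ket_space_def by measurable
  have sp: "op_apply B U \<psi> \<in> B \<rightarrow>\<^sub>E UNIV" for \<psi> by (simp add: op_apply_def)
  define F where "F = (\<lambda>\<psi> \<eta>. indicator C \<psi> * indicator ?K (\<lambda>b\<in>B. \<psi> b + (-1::real) *\<^sub>R \<eta> b) :: ennreal)"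
  have F_meas [measurable]: "(\<lambda>p. F (fst p) (snd p)) \<in> borel_measurable (?L \<Otimes>\<^sub>M ?L)"
    unfolding F_def by measurable
  have F2: "(\<lambda>(\<psi>, \<eta>). F (?T \<psi>) \<eta>) \<in> borel_measurable (?L \<Otimes>\<^sub>M ?L)"
    using measurable_compose[OF _ F_meas, of "\<lambda>p. (?T (fst p), snd p)" "?L \<Otimes>\<^sub>M ?L"]
    by (simp add: case_prod_beta)
  have "emeasure (distr ?L ?L ?T) C * ?\<kappa> = (\<integral>\<^sup>+\<psi>. indicator C (?T \<psi>) * ?\<kappa> \<partial>?L)"
  proof -
    have "emeasure (distr ?L ?L ?T) C = (\<integral>\<^sup>+\<psi>. indicator C (?T \<psi>) \<partial>?L)"
      using nn_integral_distr[OF measurable_op_apply, of "indicator C" B U] by simp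
    then show ?thesis by (simp add: nn_integral_multc)
  qed
  also have "\<dots> = (\<integral>\<^sup>+\<psi>. \<integral>\<^sup>+\<eta>. F (?T \<psi>) \<eta> \<partial>?L \<partial>?L)"
  proof (rule nn_integral_cong)
    fix \<psi>
    have "(\<integral>\<^sup>+\<eta>. F (?T \<psi>) \<eta> \<partial>?L)
        = (\<integral>\<^sup>+\<eta>. indicator C (?T \<psi>) * indicator ?K \<eta> \<partial>?L)"
      unfolding F_def by (rule nn_integral_ket_space_affine[OF B]) auto
    then show "indicator C (?T \<psi>) * ?\<kappa> = (\<integral>\<^sup>+\<eta>. F (?T \<psi>) \<eta> \<partial>?L)"
      by (simp add: nn_integral_cmult)
  qed
  also have "\<dots> = (\<integral>\<^sup>+\<eta>. \<integral>\<^sup>+\<psi>. F (?T \<psi>) \<eta> \<partial>?L \<partial>?L)"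
    by (rule P.Fubini'[OF F2, symmetric])
  also have "\<dots> = (\<integral>\<^sup>+\<eta>. \<integral>\<^sup>+\<psi>. indicator C (\<lambda>b\<in>B. ?T \<psi> b + \<eta> b) * indicator ?K \<psi> \<partial>?L \<partial>?L)"
  proof (rule nn_integral_cong)
    fix \<eta> assume \<eta>: "\<eta> \<in> space ?L"
    define w where "w = op_apply B (\<lambda>a b. cnj (U b a)) \<eta>"
    have Tw: "?T w = \<eta>"
      unfolding w_def by (rule op_apply_inverse[OF B U]) (use \<eta> in \<open>simp add: space_ket_space\<close>)
    have T_add: "?T (\<lambda>b\<in>B. w b + 1 *\<^sub>R \<psi> b) = (\<lambda>b\<in>B. ?T \<psi> b + \<eta> b)" for \<psi>
      unfolding Tw[symmetric] by (auto simp: op_apply_def fun_eq_iff algebra_simps sum.distrib)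
    have m: "(\<lambda>\<psi>. F (?T \<psi>) \<eta>) \<in> borel_measurable ?L"
      using measurable_compose[OF measurable_Pair2'[OF \<eta>] F2] by simp
    have "(\<integral>\<^sup>+\<psi>. F (?T \<psi>) \<eta> \<partial>?L) = (\<integral>\<^sup>+\<psi>. F (?T (\<lambda>b\<in>B. w b + 1 *\<^sub>R \<psi> b)) \<eta> \<partial>?L)"
      by (rule nn_integral_ket_space_affine[OF B _ m, symmetric]) simp
    also have "\<dots> = (\<integral>\<^sup>+\<psi>. indicator C (\<lambda>b\<in>B. ?T \<psi> b + \<eta> b) * indicator ?K \<psi> \<partial>?L)"
    proof (rule nn_integral_cong)
      fix \<psi> assume "\<psi> \<in> space ?L"
      then have \<psi>: "\<psi> \<in> B \<rightarrow>\<^sub>E UNIV" by (simp add: space_ket_space)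
      have "(\<lambda>b\<in>B. (\<lambda>b\<in>B. ?T \<psi> b + \<eta> b) b + (-1::real) *\<^sub>R \<eta> b) = ?T \<psi>"
        by (auto simp: op_apply_def fun_eq_iff)
      then show "F (?T (\<lambda>b\<in>B. w b + 1 *\<^sub>R \<psi> b)) \<eta>
          = indicator C (\<lambda>b\<in>B. ?T \<psi> b + \<eta> b) * indicator ?K \<psi>"
        unfolding T_add F_def using op_apply_ball_iff[OF B U \<psi>] by (simp add: indicator_def)
    qed
    finally show "(\<integral>\<^sup>+\<psi>. F (?T \<psi>) \<eta> \<partial>?L)
        = (\<integral>\<^sup>+\<psi>. indicator C (\<lambda>b\<in>B. ?T \<psi> b + \<eta> b) * indicator ?K \<psi> \<partial>?L)" .
  qed
  also have "\<dots> = (\<integral>\<^sup>+\<psi>. \<integral>\<^sup>+\<eta>. indicator C (\<lambda>b\<in>B. ?T \<psi> b + \<eta> b) * indicator ?K \<psi> \<partial>?L \<partial>?L)"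
  proof (rule P.Fubini')
    have a: "(\<lambda>p. \<lambda>b\<in>B. ?T (fst p) b + snd p b) \<in> ?L \<Otimes>\<^sub>M ?L \<rightarrow>\<^sub>M ?L"
      using measurable_compose[OF _ add_meas[of 1], of "\<lambda>p. (?T (fst p), snd p)" "?L \<Otimes>\<^sub>M ?L"]
      by simp
    have [measurable]: "(\<lambda>p. indicator C (\<lambda>b\<in>B. ?T (fst p) b + snd p b) :: ennreal)
        \<in> borel_measurable (?L \<Otimes>\<^sub>M ?L)"
      by (rule measurable_compose[OF a borel_measurable_indicator[OF C]])
    show "(\<lambda>(\<psi>, \<eta>). indicator C (\<lambda>b\<in>B. ?T \<psi> b + \<eta> b) * indicator ?K \<psi> :: ennreal)
        \<in> borel_measurable (?L \<Otimes>\<^sub>M ?L)"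
      unfolding case_prod_beta by (rule borel_measurable_times_ennreal) measurable
  qed
  also have "\<dots> = (\<integral>\<^sup>+\<psi>. indicator ?K \<psi> * emeasure ?L C \<partial>?L)"
  proof (rule nn_integral_cong)
    fix \<psi>
    have m: "(\<lambda>\<eta>. indicator C \<eta> * indicator ?K \<psi> :: ennreal) \<in> borel_measurable ?L" by simp
    have "(\<integral>\<^sup>+\<eta>. indicator C (\<lambda>b\<in>B. ?T \<psi> b + (1::real) *\<^sub>R \<eta> b) * indicator ?K \<psi> \<partial>?L)
        = (\<integral>\<^sup>+\<eta>. indicator C \<eta> * indicator ?K \<psi> \<partial>?L)"
      by (rule nn_integral_ket_space_affine[OF B _ m]) simp
    then show "(\<integral>\<^sup>+\<eta>. indicator C (\<lambda>b\<in>B. ?T \<psi> b + \<eta> b) * indicator ?K \<psi> \<partial>?L)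
        = indicator ?K \<psi> * emeasure ?L C"
      by (simp add: nn_integral_multc mult.commute)
  qed
  also have "\<dots> = emeasure ?L C * ?\<kappa>"
    by (simp add: nn_integral_multc mult.commute)
  finally show "emeasure (distr ?L ?L ?T) C = emeasure ?L C"
    using emeasure_ket_ball[OF B] by (simp add: ennreal_mult_cancel_left mult.commute[of _ "emeasure (ket_space B) (ket_ball B)"])
qed simp

lemma haar_sphere_unitary_invariant:
  assumes B: "finite B" and U: "unitary_on B U"
  shows "distr (haar_sphere B) (\<Pi>\<^sub>M b\<in>B. borel) (op_apply B U) = haar_sphere B"
proof -
  let ?L = "ket_space B" and ?K = "ket_ball B" and ?T = "op_apply B U"
  let ?u = "uniform_measure ?L ?K" and ?b = "\<Pi>\<^sub>M b\<in>B. (borel :: complex measure)"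
  have u: "distr ?u ?L ?T = ?u"
  proof (rule measure_eqI)
    fix C assume "C \<in> sets (distr ?u ?L ?T)"
    then have C [measurable]: "C \<in> sets ?L" by simp
    have pre: "?T -` C \<inter> space ?L \<in> sets ?L" by (rule measurable_sets[OF measurable_op_apply C])
    have "emeasure (distr ?u ?L ?T) C = emeasure ?L (?K \<inter> (?T -` C \<inter> space ?L)) / emeasure ?L ?K"
      using pre by (simp add: emeasure_distr)
    also have "?K \<inter> (?T -` C \<inter> space ?L) = ?T -` (?K \<inter> C) \<inter> space ?L"
      using op_apply_ball_iff[OF B U] by (auto simp: space_ket_space)
    also have "emeasure ?L \<dots> = emeasure (distr ?L ?L ?T) (?K \<inter> C)"
      by (simp add: emeasure_distr)
    also have "\<dots> = emeasure ?L (?K \<inter> C)"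
      by (simp add: ket_space_unitary_invariant[OF B U])
    finally show "emeasure (distr ?u ?L ?T) C = emeasure ?u C" by simp
  qed simp
  have comm: "?T (normalise B \<psi>) = normalise B (?T \<psi>)" for \<psi>
    unfolding normalise_def ket_norm_op_apply[OF B U]
    by (auto simp: op_apply_def fun_eq_iff sum_divide_distrib)
  have T: "?T \<in> ?b \<rightarrow>\<^sub>M ?b"
    using measurable_op_apply[of B U] by (simp add: measurable_cong_sets[OF sets_ket_space sets_ket_space])
  have "distr (haar_sphere B) ?b ?T = distr ?u ?b (?T \<circ> normalise B)"
    unfolding haar_sphere_def by (rule distr_distr[OF T]) (simp add: measurable_normalise)
  also have "?T \<circ> normalise B = normalise B \<circ> ?T" by (auto simp: comm)
  also have "distr ?u ?b (normalise B \<circ> ?T) = distr (distr ?u ?L ?T) ?b (normalise B)"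
    by (rule distr_distr[symmetric]) simp_all
  also have "\<dots> = haar_sphere B" by (simp add: u haar_sphere_def)
  finally show ?thesis .
qed

text \<open>
  The vertices are the elements of a finite type \<open>'v\<close>, so \<open>N = CARD('v)\<close>.  The computational
  basis of the qubits in \<open>S\<close> consists of the bit assignments \<open>S \<rightarrow>\<^sub>E UNIV\<close>; for \<open>S = UNIV\<close>
  these are all functions \<open>'v \<Rightarrow> bool\<close>, and \<open>(\<complex>\<^sup>2)\<^sup>\<otimes>\<^sup>N\<close> is \<open>complex ^ ('v \<Rightarrow> bool)\<close>.
\<close>

definition qubit_basis :: "'v set \<Rightarrow> ('v \<Rightarrow> bool) set" where
  "qubit_basis S = (S \<rightarrow>\<^sub>E UNIV)"

text \<open>
  The edges are \<open>I 1, \<dots>, I M\<close>; they may repeat, simple hypergraphs being the case that \<open>I\<close> is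
  injective on \<open>{1..M}\<close>.
\<close>

definition uniform_hypergraph :: "nat \<Rightarrow> nat \<Rightarrow> (nat \<Rightarrow> 'v::finite set) \<Rightarrow> bool" where
  "uniform_hypergraph k M I \<longleftrightarrow> (\<forall>m\<in>{1..M}. card (I m) = k)"

text \<open>The operator \<open>|\<phi>\<rangle>\<langle>\<phi>|\<close>, by its matrix entries.\<close>

definition ketbra :: "('b \<Rightarrow> complex) \<Rightarrow> 'b \<Rightarrow> 'b \<Rightarrow> complex" where
  "ketbra \<phi> a b = \<phi> a * cnj (\<phi> b)"

text \<open>
  An operator \<open>A\<close> on the qubits in \<open>S\<close>, tensored with the identity on the remaining qubits.
\<close>

definition acting_on ::
  "'v::finite set \<Rightarrow> (('v \<Rightarrow> bool) \<Rightarrow> ('v \<Rightarrow> bool) \<Rightarrow> complex)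
     \<Rightarrow> complex ^ ('v \<Rightarrow> bool) ^ ('v \<Rightarrow> bool)" where
  "acting_on S A =
     (\<chi> x y. A (restrict x S) (restrict y S) * (if restrict x (- S) = restrict y (- S) then 1 else 0))"

definition edge_projector ::
  "'v::finite set \<Rightarrow> (('v \<Rightarrow> bool) \<Rightarrow> complex) \<Rightarrow> complex ^ ('v \<Rightarrow> bool) ^ ('v \<Rightarrow> bool)" where
  "edge_projector S \<phi> = acting_on S (ketbra \<phi>)"

definition hamiltonian ::
  "nat \<Rightarrow> (nat \<Rightarrow> 'v::finite set) \<Rightarrow> (nat \<Rightarrow> ('v \<Rightarrow> bool) \<Rightarrow> complex)
     \<Rightarrow> complex ^ ('v \<Rightarrow> bool) ^ ('v \<Rightarrow> bool)" where
  "hamiltonian M I \<phi> = (\<Sum>m=1..M. edge_projector (I m) (\<phi> m))"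

definition ker_op :: "complex ^ 'n ^ 'm \<Rightarrow> (complex ^ 'n) set" where
  "ker_op A = {\<psi>. A *v \<psi> = 0}"

text \<open>The joint law of the independent choices \<open>\<phi> 1, \<dots>, \<phi> M\<close>.\<close>

definition random_qsat ::
  "nat \<Rightarrow> (nat \<Rightarrow> 'v::finite set) \<Rightarrow> (nat \<Rightarrow> ('v \<Rightarrow> bool) \<Rightarrow> complex) measure" where
  "random_qsat M I = (\<Pi>\<^sub>M m\<in>{1..M}. haar_sphere (qubit_basis (I m)))"

end

theory Submission
  imports Defs
begin

text \<open>
  Let \<open>D\<close> be the least kernel dimension, attained at \<open>\<phi>0\<close>, and let \<open>Q = \<Sum>b |b\<rangle>\<langle>b|\<close> over a basis
  of the kernel of \<open>H \<phi>0\<close>.  Then \<open>H \<phi>0 + Q\<close> is invertible, and invertibility of \<open>H \<phi> + Q\<close>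
  forces \<open>dim (ker (H \<phi>)) \<le> D\<close>, because \<open>Q\<close> has rank at most \<open>D\<close>.  So it suffices that
  invertibility survives, almost surely, when a single edge state is resampled.

  Positivity shows that \<open>H \<phi> + Q\<close> is invertible as soon as
  \<open>(\<Sum>m |\<xi> m\<rangle>\<langle>\<phi> m|) + Q\<close> is, for any \<open>\<xi>\<close>, and that rescaling the states \<open>\<phi> m\<close> to unit norm
  does no harm.  With \<open>\<xi>\<close> the state before resampling, the determinant of the latter matrix is a
  polynomial in each single conjugate coordinate of the resampled state, so on every complex
  coordinate line where it is not identically zero it has finitely many zeros.
\<close>

section \<open>Resampling the coordinates of a product measure one at a time\<close>

text \<open>By induction on \<open>J\<close>: freeze the new coordinate at its value in
  \<open>u\<close>, so that the induction hypothesis spreads \<open>P\<close> over the old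
  coordinates from \<open>restrict u J\<close>; then resample the new one.\<close>

lemma (in product_sigma_finite) AE_PiM_of_AE_fun_upd:
  assumes "finite J"
    and "{x \<in> space (PiM J M). P x} \<in> sets (PiM J M)"
    and "u \<in> space (PiM J M)" "P u"
    and "\<And>x j. x \<in> space (PiM J M) \<Longrightarrow> j \<in> J \<Longrightarrow> P x \<Longrightarrow> AE t in M j. P (x(j := t))"
  shows "AE x in PiM J M. P x"
  using assms
proof (induction J arbitrary: P u rule: finite_induct)
  case empty
  then show ?case by (auto simp: space_PiM)
next
  case (insert i J)
  have Pm: "Measurable.pred (PiM (insert i J) M) P"
    using insert.prems(1) by (simp add: pred_def)
  have upd': "x(i := t) \<in> space (PiM (insert i J) M)"
    if "x \<in> space (PiM J M)" "t \<in> space (M i)" for x t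
    using that by (auto simp: space_PiM PiE_iff extensional_def)
  define t0 where "t0 = u i"
  define y0 where "y0 = restrict u J"
  have t0: "t0 \<in> space (M i)"
    using insert.prems(2) by (auto simp: t0_def space_PiM)
  have y0: "y0 \<in> space (PiM J M)"
    using insert.prems(2) by (auto simp: y0_def space_PiM)
  have u: "y0(i := t0) = u"
    using insert.prems(2) insert.hyps(2)
    by (auto simp: y0_def t0_def space_PiM PiE_iff extensional_def fun_eq_iff)
  have "AE x in PiM J M. P (x(i := t0))"
  proof (rule insert.IH[of "\<lambda>x. P (x(i := t0))" y0])
    have "(\<lambda>x. x(i := t0)) \<in> PiM J M \<rightarrow>\<^sub>M PiM (insert i J) M"
      using t0 by (intro measurable_fun_upd[where J = J]) auto
    from measurable_compose[OF this Pm]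
    show "{x \<in> space (PiM J M). P (x(i := t0))} \<in> sets (PiM J M)"
      by (simp add: pred_def)
  next
    fix x j assume x: "x \<in> space (PiM J M)" and j: "j \<in> J" and P: "P (x(i := t0))"
    have "AE t in M j. P ((x(i := t0))(j := t))"
      by (rule insert.prems(4)[OF upd'[OF x t0] _ P]) (use j in simp)
    moreover have "i \<noteq> j" using j insert.hyps by auto
    ultimately show "AE t in M j. P ((x(j := t))(i := t0))"
      by (simp add: fun_upd_twist)
  qed (use u insert.prems y0 in auto)
  then have *: "AE x in PiM J M. AE t in M i. P (x(i := t))"
    using AE_space
  proof eventually_elim
    case (elim x)
    have "AE t in M i. P ((x(i := t0))(i := t))"
      by (rule insert.prems(4)[OF upd'[OF elim(2) t0] _ elim(1)]) simp
    then show ?case by simp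
  qed
  \<comment> \<open>By Fubini the failure set of \<open>P\<close> is null, since almost all of its
    sections in the coordinate \<open>i\<close> are null.\<close>
  have "(\<integral>\<^sup>+x. indicator {x. \<not> P x} x \<partial>PiM (insert i J) M)
      = (\<integral>\<^sup>+x. (\<integral>\<^sup>+t. indicator {x. \<not> P x} (x(i := t)) \<partial>M i) \<partial>PiM J M)"
    using Pm insert.hyps by (intro product_nn_integral_insert) auto
  also have "\<dots> = (\<integral>\<^sup>+x. 0 \<partial>PiM J M)"
  proof (rule nn_integral_cong_AE, use * in eventually_elim)
    case (elim x)
    then have "(\<integral>\<^sup>+t. indicator {x. \<not> P x} (x(i := t)) \<partial>M i) = (\<integral>\<^sup>+t. 0 \<partial>M i)"
      by (intro nn_integral_cong_AE) (auto elim!: eventually_mono simp: indicator_def)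
    then show ?case by simp
  qed
  finally have "AE x in PiM (insert i J) M. indicator {x. \<not> P x} x = (0::ennreal)"
    using Pm by (subst nn_integral_0_iff_AE[symmetric]) auto
  then show ?case by (auto elim!: eventually_mono simp: indicator_def split: if_splits)
qed

section \<open>Determinants along a complex line of matrices\<close>

lemma det_affine_eq_poly:
  fixes A C :: "complex ^ 'n ^ 'n"
  shows "\<exists>p. \<forall>w. det (\<chi> i j. A $ i $ j + w * C $ i $ j) = poly p w"
proof (intro exI allI)
  show "det (\<chi> i j. A $ i $ j + w * C $ i $ j)
      = poly (\<Sum>q | q permutes UNIV. of_int (sign q) * (\<Prod>i\<in>UNIV. [:A $ i $ q i, C $ i $ q i:])) w" for w
    by (simp add: det_def poly_sum poly_prod)
qed

lemma det_affine_cnj_AE_nonzero: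
  fixes A C :: "complex ^ 'n ^ 'n"
  assumes "det (\<chi> i j. A $ i $ j + w * C $ i $ j) \<noteq> 0"
  shows "AE z in lborel. det (\<chi> i j. A $ i $ j + cnj z * C $ i $ j) \<noteq> 0"
proof -
  obtain p where p: "\<And>w. det (\<chi> i j. A $ i $ j + w * C $ i $ j) = poly p w"
    using det_affine_eq_poly[of A C] by blast
  have "p \<noteq> 0" using assms p by auto
  then have "finite (cnj ` {w. poly p w = 0})" by (simp add: poly_roots_finite)
  then have "cnj ` {w. poly p w = 0} \<in> null_sets lborel"
    by (intro finite_imp_null_set_lborel)
  then have "AE z in lborel. z \<notin> cnj ` {w. poly p w = 0}" by (rule AE_not_in)
  then show ?thesis
    by (rule eventually_mono) (auto simp: p image_iff dest!: spec[of _ "cnj _"])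
qed

lemma det_nz_iff_ker:
  fixes A :: "'a::field ^ 'n ^ 'n"
  shows "det A \<noteq> 0 \<longleftrightarrow> (\<forall>\<psi>. A *v \<psi> = 0 \<longrightarrow> \<psi> = 0)"
  by (simp flip: invertible_det_nz add: invertible_left_inverse matrix_left_invertible_ker)

lemma borel_measurable_det:
  fixes A :: "'a \<Rightarrow> complex ^ 'n ^ 'n"
  assumes "\<And>i j. (\<lambda>x. A x $ i $ j) \<in> borel_measurable N"
  shows "(\<lambda>x. det (A x)) \<in> borel_measurable N"
  using assms unfolding det_def by measurable

section \<open>Positivity and quadratic forms\<close>

text \<open>The operator Q of the overview, the sum of |b><b| over \<open>B\<close>.\<close>

definition gram :: "(complex ^ 'n) set \<Rightarrow> complex ^ 'n ^ 'n" where
  "gram B = (\<chi> x y. \<Sum>b\<in>B. b $ x * cnj (b $ y))"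

text \<open>The expectation <\<psi>|A|\<psi>>.\<close>

definition qform :: "complex ^ 'n ^ 'n \<Rightarrow> complex ^ 'n \<Rightarrow> complex" where
  "qform A \<psi> = (\<Sum>x\<in>UNIV. cnj (\<psi> $ x) * (A *v \<psi>) $ x)"

lemma gram_mult: "gram B *v \<psi> = (\<Sum>b\<in>B. (\<Sum>y\<in>UNIV. cnj (b $ y) * \<psi> $ y) *s b)"
proof -
  have "(gram B *v \<psi>) $ x = (\<Sum>b\<in>B. (\<Sum>y\<in>UNIV. cnj (b $ y) * \<psi> $ y) * b $ x)" for x
    unfolding gram_def matrix_vector_mult_def
    by (simp add: sum_distrib_left sum_distrib_right sum.swap[of _ B UNIV] mult_ac)
  then show ?thesis by (simp add: vec_eq_iff)
qed

lemma qform_gram: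
  "qform (gram B) \<psi> = of_real (\<Sum>b\<in>B. (cmod (\<Sum>y\<in>UNIV. cnj (b $ y) * \<psi> $ y))\<^sup>2)"
proof -
  have "qform (gram B) \<psi>
      = (\<Sum>b\<in>B. (\<Sum>y\<in>UNIV. cnj (b $ y) * \<psi> $ y) * cnj (\<Sum>y\<in>UNIV. cnj (b $ y) * \<psi> $ y))"
  proof -
    have "qform (gram B) \<psi> = (\<Sum>b\<in>B. \<Sum>x\<in>UNIV.
        (\<Sum>y\<in>UNIV. cnj (b $ y) * \<psi> $ y) * (b $ x * cnj (\<psi> $ x)))"
      unfolding qform_def gram_mult
      by (subst sum.swap) (simp add: sum_distrib_left sum_component mult_ac)
    then show ?thesis by (simp flip: sum_distrib_left)
  qed
  then show ?thesis by (simp only: of_real_sum complex_norm_square)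
qed

lemma qform_add: "qform (A + B) \<psi> = qform A \<psi> + qform B \<psi>"
  by (simp add: qform_def matrix_vector_mult_add_rdistrib algebra_simps sum.distrib)

lemma matrix_sum_mult: "(\<Sum>m\<in>S. A m) *v \<psi> = (\<Sum>m\<in>S. A m *v (\<psi> :: complex ^ 'n))"
  by (induction S rule: infinite_finite_induct) (auto simp: matrix_vector_mult_add_rdistrib)

lemma qform_sum: "qform (\<Sum>m\<in>S. A m) \<psi> = (\<Sum>m\<in>S. qform (A m) \<psi>)"
  unfolding qform_def matrix_sum_mult
  by (simp add: sum_distrib_left sum.swap[of _ S UNIV])

section \<open>Overlaps with edge states and the kernel of the Hamiltonian\<close>

text \<open>The component of \<open>\<langle>\<phi>|\<psi>\<rangle>\<close> along the basis state \<open>z\<close> of the qubits outside \<open>S\<close>.\<close>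

definition bra ::
  "'v::finite set \<Rightarrow> (('v \<Rightarrow> bool) \<Rightarrow> complex) \<Rightarrow> complex ^ ('v \<Rightarrow> bool) \<Rightarrow> ('v \<Rightarrow> bool) \<Rightarrow> complex" where
  "bra S \<phi> \<psi> z = (\<Sum>y | restrict y (- S) = z. cnj (\<phi> (restrict y S)) * \<psi> $ y)"

text \<open>
  Unlike \<open>hamiltonian M I \<phi>\<close>, which is sesquilinear, this is antilinear in \<open>\<phi>\<close>, so that
  determinants built from it are polynomials in one complex variable.
\<close>

definition mixed_ham ::
  "nat \<Rightarrow> (nat \<Rightarrow> 'v::finite set) \<Rightarrow> (nat \<Rightarrow> ('v \<Rightarrow> bool) \<Rightarrow> complex)
     \<Rightarrow> (nat \<Rightarrow> ('v \<Rightarrow> bool) \<Rightarrow> complex) \<Rightarrow> complex ^ ('v \<Rightarrow> bool) ^ ('v \<Rightarrow> bool)" where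
  "mixed_ham M I \<xi> \<phi> = (\<Sum>m=1..M. acting_on (I m) (\<lambda>a b. \<xi> m a * cnj (\<phi> m b)))"

lemma mixed_ham_same: "mixed_ham M I \<phi> \<phi> = hamiltonian M I \<phi>"
  by (simp add: mixed_ham_def hamiltonian_def edge_projector_def ketbra_def[abs_def])

lemma acting_on_outer_mult:
  "(acting_on S (\<lambda>a b. \<xi> a * cnj (\<phi> b)) *v \<psi>) $ x
     = \<xi> (restrict x S) * bra S \<phi> \<psi> (restrict x (- S))"
  unfolding acting_on_def matrix_vector_mult_def bra_def
  by (simp add: sum_distrib_left sum.inter_filter[symmetric] if_distrib if_distribR mult_ac eq_commute
      cong: if_cong)

text \<open>Grouping the basis states by their bits outside \<open>S\<close> makes the overlap
  constant on each group; the remaining sum over the group is its conjugate.\<close>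

lemma qform_edge_projector:
  fixes S :: "'v::finite set"
  shows "qform (edge_projector S \<phi>) \<psi>
    = of_real (\<Sum>z\<in>range (\<lambda>x. restrict x (- S)). (cmod (bra S \<phi> \<psi> z))\<^sup>2)"
proof -
  let ?r = "\<lambda>x :: 'v \<Rightarrow> bool. restrict x (- S)"
  have "qform (edge_projector S \<phi>) \<psi>
      = (\<Sum>x\<in>UNIV. cnj (\<psi> $ x) * (\<phi> (restrict x S) * bra S \<phi> \<psi> (?r x)))"
    unfolding qform_def edge_projector_def ketbra_def[abs_def] acting_on_outer_mult ..
  also have "\<dots> = (\<Sum>z\<in>range ?r. \<Sum>x | x \<in> UNIV \<and> ?r x = z.
      cnj (\<psi> $ x) * (\<phi> (restrict x S) * bra S \<phi> \<psi> (?r x)))"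
    by (rule sum.image_gen) simp
  also have "\<dots> = (\<Sum>z\<in>range ?r. bra S \<phi> \<psi> z * cnj (bra S \<phi> \<psi> z))"
  proof (rule sum.cong[OF refl])
    fix z
    have "(\<Sum>x | x \<in> UNIV \<and> ?r x = z. cnj (\<psi> $ x) * (\<phi> (restrict x S) * bra S \<phi> \<psi> (?r x)))
       = (\<Sum>x | ?r x = z. bra S \<phi> \<psi> z * (cnj (\<psi> $ x) * \<phi> (restrict x S)))"
      by (rule sum.cong) auto
    also have "\<dots> = bra S \<phi> \<psi> z * cnj (bra S \<phi> \<psi> z)"
      by (subst (3) bra_def) (simp add: sum_distrib_left mult_ac)
    finally show "(\<Sum>x | x \<in> UNIV \<and> ?r x = z.
        cnj (\<psi> $ x) * (\<phi> (restrict x S) * bra S \<phi> \<psi> (?r x))) = bra S \<phi> \<psi> z * cnj (bra S \<phi> \<psi> z)" .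
  qed
  finally show ?thesis by (simp only: of_real_sum complex_norm_square)
qed

text \<open>The states \<xi> only multiply the overlaps with \<phi>, so vanishing overlaps suffice
  whatever \<xi> is. This carries kernel vectors from \<open>hamiltonian\<close> to
  \<open>mixed_ham\<close>.\<close>

lemma mixed_ham_mult_eq_0:
  assumes "\<And>m x. m \<in> {1..M} \<Longrightarrow> bra (I m) (\<phi> m) \<psi> (restrict x (- I m)) = 0"
  shows "mixed_ham M I \<xi> \<phi> *v \<psi> = 0"
  unfolding mixed_ham_def matrix_sum_mult
  by (intro sum.neutral ballI) (simp add: vec_eq_iff acting_on_outer_mult assms)

text \<open>The expectation of the sum at \<psi> is a sum of squared moduli of overlaps; as it is
  zero, every overlap is zero.\<close>

lemma hamiltonian_add_gram_ker:
  assumes "finite B" "(hamiltonian M I \<phi> + gram B) *v \<psi> = 0"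
  shows "m \<in> {1..M} \<Longrightarrow> bra (I m) (\<phi> m) \<psi> (restrict x (- I m)) = 0"
    and "b \<in> B \<Longrightarrow> (\<Sum>y\<in>UNIV. cnj (b $ y) * \<psi> $ y) = 0"
proof -
  define e where "e = (\<lambda>m. \<Sum>z\<in>range (\<lambda>x. restrict x (- I m)). (cmod (bra (I m) (\<phi> m) \<psi> z))\<^sup>2)"
  define g where "g = (\<Sum>b\<in>B. (cmod (\<Sum>y\<in>UNIV. cnj (b $ y) * \<psi> $ y))\<^sup>2)"
  have e: "e m \<ge> 0" for m unfolding e_def by (intro sum_nonneg) auto
  have g: "g \<ge> 0" unfolding g_def by (intro sum_nonneg) auto
  have "qform (hamiltonian M I \<phi> + gram B) \<psi> = 0"
    using assms(2) by (simp add: qform_def)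
  moreover have "qform (hamiltonian M I \<phi> + gram B) \<psi> = of_real ((\<Sum>m=1..M. e m) + g)"
    by (simp add: qform_add hamiltonian_def qform_sum qform_edge_projector qform_gram e_def g_def)
  ultimately have "(\<Sum>m=1..M. e m) + g = 0" by (metis of_real_eq_0_iff)
  moreover have "(\<Sum>m=1..M. e m) \<ge> 0" using e by (simp add: sum_nonneg)
  ultimately have 0: "(\<Sum>m=1..M. e m) = 0" "g = 0" using g by linarith+
  show "bra (I m) (\<phi> m) \<psi> (restrict x (- I m)) = 0" if "m \<in> {1..M}"
  proof -
    have "e m = 0" using 0(1) e that by (simp add: sum_nonneg_eq_0_iff)
    then show ?thesis unfolding e_def by (subst (asm) sum_nonneg_eq_0_iff) auto
  qed
  show "(\<Sum>y\<in>UNIV. cnj (b $ y) * \<psi> $ y) = 0" if "b \<in> B"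
    using 0(2) that assms(1) unfolding g_def by (subst (asm) sum_nonneg_eq_0_iff) auto
qed

text \<open>Orthogonality to \<open>B\<close> extends to its span, so \<psi> is orthogonal to
  itself.\<close>

lemma ker_orthogonal_zero:
  assumes "\<psi> \<in> vec.span B" "\<And>b. b \<in> B \<Longrightarrow> (\<Sum>y\<in>UNIV. cnj (b $ y) * \<psi> $ y) = 0"
  shows "\<psi> = (0 :: complex ^ 'n)"
proof -
  have "(\<Sum>y\<in>UNIV. cnj (v $ y) * \<psi> $ y) = 0" if "v \<in> vec.span B" for v
    using that
  proof (induction rule: vec.span_induct_alt)
    case (step c x y)
    then show ?case
      using assms(2)[of x] by (simp add: algebra_simps sum.distrib flip: sum_distrib_left)
  qed auto
  from this[OF assms(1)] have "(\<Sum>y\<in>UNIV. complex_of_real ((cmod (\<psi> $ y))\<^sup>2)) = 0"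
    unfolding complex_norm_square by (simp add: mult.commute)
  then have "(\<Sum>y\<in>UNIV. (cmod (\<psi> $ y))\<^sup>2) = 0" by (metis of_real_eq_0_iff of_real_sum)
  then show ?thesis by (simp add: sum_nonneg_eq_0_iff vec_eq_iff)
qed

text \<open>By positivity a kernel vector of the sum is annihilated by the Hamiltonian, hence lies
  in the span of \<open>B\<close>, and is also orthogonal to \<open>B\<close>.\<close>

lemma det_hamiltonian_add_gram_nz:
  assumes "finite B" "ker_op (hamiltonian M I \<phi>) \<subseteq> vec.span B"
  shows "det (hamiltonian M I \<phi> + gram B) \<noteq> 0"
  unfolding det_nz_iff_ker
proof (intro allI impI)
  fix \<psi> assume *: "(hamiltonian M I \<phi> + gram B) *v \<psi> = 0"
  have "mixed_ham M I \<phi> \<phi> *v \<psi> = 0"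
    by (rule mixed_ham_mult_eq_0) (rule hamiltonian_add_gram_ker(1)[OF assms(1) *])
  then have "\<psi> \<in> vec.span B"
    using assms(2) by (auto simp: mixed_ham_same ker_op_def)
  then show "\<psi> = 0"
    by (rule ker_orthogonal_zero) (rule hamiltonian_add_gram_ker(2)[OF assms(1) *])
qed

text \<open>Invertibility of the sum makes \<open>gram B\<close> injective on the kernel of
  \<open>A\<close>, and its image lies in the span of \<open>B\<close>.\<close>

lemma dim_ker_le_card_gram:
  fixes A :: "complex ^ 'n ^ 'n"
  assumes "finite B" "det (A + gram B) \<noteq> 0"
  shows "vec.dim (ker_op A) \<le> card B"
proof -
  have ss: "vec.subspace (ker_op A)"
    by (auto simp: vec.subspace_def ker_op_def matrix_vector_right_distrib vector_scalar_commute)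
  have "inj_on ((*v) (gram B)) (ker_op A)"
  proof (rule inj_onI)
    fix u v assume "u \<in> ker_op A" "v \<in> ker_op A" "gram B *v u = gram B *v v"
    then have "(A + gram B) *v (u - v) = 0"
      by (simp add: ker_op_def algebra_simps)
    then have "u - v = 0" using assms(2) unfolding det_nz_iff_ker by blast
    then show "u = v" by simp
  qed
  then have "vec.dim (ker_op A) = vec.dim ((*v) (gram B) ` ker_op A)"
    using ss by (intro vec.dim_image_eq[symmetric]) (auto simp: vec.span_eq_iff[THEN iffD2])
  also have "\<dots> \<le> card B"
    by (rule vec.dim_le_card)
       (auto simp: gram_mult assms intro!: vec.span_sum vec.span_scale intro: vec.span_base)
  finally show ?thesis .
qed

section \<open>Resampling a single edge state\<close>

text \<open>Written as a product, not a quotient, so that it covers norm zero: then \<phi> vanishes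
  on the basis and so does its overlap.\<close>

lemma bra_normalise:
  "bra S \<phi> \<psi> z = of_real (ket_norm (qubit_basis S) \<phi>) * bra S (normalise (qubit_basis S) \<phi>) \<psi> z"
proof -
  have [simp]: "restrict y S \<in> qubit_basis S" for y by (simp add: qubit_basis_def)
  have "\<phi> b = of_real (ket_norm (qubit_basis S) \<phi>) * normalise (qubit_basis S) \<phi> b"
    if "b \<in> qubit_basis S" for b
  proof (cases "ket_norm (qubit_basis S) \<phi> = 0")
    case True
    then have "\<phi> b = 0" using that by (simp add: ket_norm_def L2_set_eq_0_iff)
    with True show ?thesis by simp
  next
    case False
    with that show ?thesis by (simp add: normalise_def)
  qed
  then have "cnj (\<phi> (restrict y S)) = of_real (ket_norm (qubit_basis S) \<phi>)
      * cnj (normalise (qubit_basis S) \<phi> (restrict y S))" for y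
    by (metis \<open>\<And>y. restrict y S \<in> qubit_basis S\<close> complex_cnj_complex_of_real complex_cnj_mult)
  then show ?thesis by (simp add: bra_def sum_distrib_left mult_ac)
qed

text \<open>Both families of states may vary with \<open>t\<close>, so the case of equal families
  covers the Hamiltonian itself.\<close>

lemma borel_measurable_det_mixed_ham:
  assumes "\<And>m b. m \<in> {1..M} \<Longrightarrow> b \<in> qubit_basis (I m) \<Longrightarrow> (\<lambda>t. \<xi> t m b) \<in> borel_measurable N"
    and "\<And>m b. m \<in> {1..M} \<Longrightarrow> b \<in> qubit_basis (I m) \<Longrightarrow> (\<lambda>t. \<phi> t m b) \<in> borel_measurable N"
  shows "(\<lambda>t. det (mixed_ham M I (\<xi> t) (\<phi> t) + G)) \<in> borel_measurable N"
proof (rule borel_measurable_det)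
  have *: "restrict x S \<in> qubit_basis S" for x and S :: "'a set"
    by (simp add: qubit_basis_def)
  have [measurable]: "cnj \<in> borel_measurable borel"
    by (intro borel_measurable_continuous_onI continuous_intros)
  note [measurable] = assms[OF _ *]
  show "(\<lambda>t. (mixed_ham M I (\<xi> t) (\<phi> t) + G) $ i $ j) \<in> borel_measurable N" for i j
    unfolding mixed_ham_def acting_on_def by (simp add: sum_component) measurable
qed

lemma mixed_ham_upd_coordinate:
  "\<exists>A C. \<forall>z. mixed_ham M I \<xi> (\<phi>(m := \<psi>(b := z))) + G
    = (\<chi> i j. A $ i $ j + cnj z * C $ i $ j)"
proof (intro exI allI)
  let ?d = "\<lambda>l i j. if restrict i (- I l) = restrict j (- I l) then 1 else 0"
  \<comment> \<open>\<open>?A\<close> is the matrix with coordinate \<open>b\<close> set to zero;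
    \<open>?C\<close> collects the coefficients of \<open>cnj z\<close>, which occur in the columns
    that restrict to \<open>b\<close> on edge \<open>m\<close>.\<close>
  let ?A = "mixed_ham M I \<xi> (\<phi>(m := \<psi>(b := 0))) + G"
  let ?C = "(\<chi> i j. \<Sum>l=1..M. if l = m \<and> restrict j (I l) = b then \<xi> l (restrict i (I l)) * ?d l i j else 0)"
  show "mixed_ham M I \<xi> (\<phi>(m := \<psi>(b := z))) + G = (\<chi> i j. ?A $ i $ j + cnj z * ?C $ i $ j)" for z
  proof -
    have "mixed_ham M I \<xi> (\<phi>(m := \<psi>(b := z))) $ i $ j
        = mixed_ham M I \<xi> (\<phi>(m := \<psi>(b := 0))) $ i $ j + cnj z * ?C $ i $ j" for i j
      unfolding mixed_ham_def acting_on_def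
      by (simp add: sum_component sum_distrib_left flip: sum.distrib) (rule sum.cong, auto)
    then show ?thesis by (simp add: vec_eq_iff)
  qed
qed

text \<open>Lebesgue measure on the states of one edge is a product over basis coordinates. The old
  state \<open>\<phi> m\<close> is the starting point, and each coordinate is moved along a complex
  line with \<xi> fixed.\<close>

lemma AE_ket_space_det_mixed_ham_nz:
  fixes I :: "nat \<Rightarrow> 'v::finite set"
  assumes "m \<in> {1..M}" "\<phi> m \<in> qubit_basis (I m) \<rightarrow>\<^sub>E UNIV"
    and "det (mixed_ham M I \<xi> \<phi> + G) \<noteq> 0"
  shows "AE \<psi> in ket_space (qubit_basis (I m)). det (mixed_ham M I \<xi> (\<phi>(m := \<psi>)) + G) \<noteq> 0"
proof -
  interpret product_sigma_finite "\<lambda>_::'v \<Rightarrow> bool. lborel :: complex measure" ..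
  let ?E = "qubit_basis (I m)"
  show ?thesis
    unfolding ket_space_def
  proof (rule AE_PiM_of_AE_fun_upd[where u = "\<phi> m"])
    have "(\<lambda>\<psi>. (\<phi>(m := \<psi>)) l b) \<in> borel_measurable (PiM ?E (\<lambda>_. lborel))"
      if "b \<in> qubit_basis (I l)" for l b
      using that by (cases "l = m") auto
    then have [measurable]: "(\<lambda>\<psi>. det (mixed_ham M I \<xi> (\<phi>(m := \<psi>)) + G)) \<in> borel_measurable (PiM ?E (\<lambda>_. lborel))"
      by (intro borel_measurable_det_mixed_ham) auto
    show "{\<psi> \<in> space (PiM ?E (\<lambda>_. lborel)). det (mixed_ham M I \<xi> (\<phi>(m := \<psi>)) + G) \<noteq> 0}
        \<in> sets (PiM ?E (\<lambda>_. lborel))"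
      by measurable
  next
    fix \<psi> b assume nz: "det (mixed_ham M I \<xi> (\<phi>(m := \<psi>)) + G) \<noteq> 0"
    obtain A C where AC: "\<And>z. mixed_ham M I \<xi> (\<phi>(m := \<psi>(b := z))) + G
        = (\<chi> i j. A $ i $ j + cnj z * C $ i $ j)"
      using mixed_ham_upd_coordinate[of M I \<xi> \<phi> m \<psi> b G] by blast
    have "det (\<chi> i j. A $ i $ j + cnj (\<psi> b) * C $ i $ j) \<noteq> 0"
      using nz AC[of "\<psi> b"] by simp
    then show "AE z in lborel. det (mixed_ham M I \<xi> (\<phi>(m := \<psi>(b := z))) + G) \<noteq> 0"
      unfolding AC by (rule det_affine_cnj_AE_nonzero)
  qed (use assms in \<open>auto simp: space_PiM\<close>)
qed

text \<open>A kernel vector of the normalised sum has zero overlap with every edge state. This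
  survives undoing the normalisation, so the vector is in the kernel of the invertible mixed
  matrix.\<close>

lemma det_hamiltonian_normalise_nz:
  fixes I :: "nat \<Rightarrow> 'v::finite set"
  assumes "finite B"
    and nz: "det (mixed_ham M I \<xi> (\<phi>(m := \<psi>)) + gram B) \<noteq> 0"
  shows "det (hamiltonian M I (\<phi>(m := normalise (qubit_basis (I m)) \<psi>)) + gram B) \<noteq> 0"
  unfolding det_nz_iff_ker
proof (intro allI impI)
  let ?n = "normalise (qubit_basis (I m)) \<psi>"
  fix v assume v: "(hamiltonian M I (\<phi>(m := ?n)) + gram B) *v v = 0"
  note ker = hamiltonian_add_gram_ker[OF assms(1) v]
  have "bra (I l) ((\<phi>(m := \<psi>)) l) v (restrict x (- I l)) = 0" if "l \<in> {1..M}" for l x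
    using ker(1)[OF that, of x] bra_normalise[of "I m" \<psi>] by (cases "l = m") auto
  then have "mixed_ham M I \<xi> (\<phi>(m := \<psi>)) *v v = 0"
    by (rule mixed_ham_mult_eq_0)
  moreover have "gram B *v v = 0"
    unfolding gram_mult by (intro sum.neutral ballI) (simp add: ker(2))
  ultimately have "(mixed_ham M I \<xi> (\<phi>(m := \<psi>)) + gram B) *v v = 0"
    by (simp add: matrix_vector_mult_add_rdistrib)
  then show "v = 0"
    using nz unfolding det_nz_iff_ker by blast
qed

lemma space_haar_sphere: "space (haar_sphere B) = B \<rightarrow>\<^sub>E UNIV"
  by (simp add: haar_sphere_def space_PiM)

lemma sets_haar_sphere [measurable_cong]: "sets (haar_sphere B) = sets (\<Pi>\<^sub>M b\<in>B. borel)"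
  by (simp add: haar_sphere_def)

lemma AE_haar_sphere_det_nz:
  fixes I :: "nat \<Rightarrow> 'v::finite set"
  assumes "finite B" "m \<in> {1..M}" "\<phi> m \<in> qubit_basis (I m) \<rightarrow>\<^sub>E UNIV"
    and "det (hamiltonian M I \<phi> + gram B) \<noteq> 0"
  shows "AE \<psi> in haar_sphere (qubit_basis (I m)). det (hamiltonian M I (\<phi>(m := \<psi>)) + gram B) \<noteq> 0"
proof -
  let ?E = "qubit_basis (I m)"
  \<comment> \<open>Taking \<xi> to be the old \<phi> makes the mixed matrix at the old state the
    given invertible one.\<close>
  have "AE \<psi> in ket_space ?E. det (mixed_ham M I \<phi> (\<phi>(m := \<psi>)) + gram B) \<noteq> 0"
    using assms by (intro AE_ket_space_det_mixed_ham_nz) (auto simp: mixed_ham_same)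
  then have "AE \<psi> in ket_space ?E. det (hamiltonian M I (\<phi>(m := normalise ?E \<psi>)) + gram B) \<noteq> 0"
    by (rule eventually_mono) (rule det_hamiltonian_normalise_nz[OF assms(1)])
  then have AE: "AE \<psi> in uniform_measure (ket_space ?E) (ket_ball ?E).
      det (hamiltonian M I (\<phi>(m := normalise ?E \<psi>)) + gram B) \<noteq> 0"
    by (intro AE_uniform_measureI sets_ket_ball) auto
  have "(\<lambda>\<psi>. (\<phi>(m := \<psi>)) l b) \<in> borel_measurable (PiM ?E (\<lambda>_. borel))"
    if "b \<in> qubit_basis (I l)" for l b
    using that by (cases "l = m") auto
  then have [measurable]: "(\<lambda>\<psi>. det (hamiltonian M I (\<phi>(m := \<psi>)) + gram B)) \<in> borel_measurable (PiM ?E (\<lambda>_. borel))"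
    unfolding mixed_ham_same[symmetric] by (intro borel_measurable_det_mixed_ham) auto
  show ?thesis
    unfolding haar_sphere_def
  proof (subst AE_distr_iff)
    show "{\<psi> \<in> space (PiM ?E (\<lambda>_. borel)). det (hamiltonian M I (\<phi>(m := \<psi>)) + gram B) \<noteq> 0}
        \<in> sets (PiM ?E (\<lambda>_. borel))"
      by measurable
  qed (use AE in \<open>auto simp: measurable_normalise\<close>)
qed

section \<open>Almost sure constancy of the kernel dimension\<close>

theorem mainTheorem1:
  fixes I :: "nat \<Rightarrow> 'v::finite set" and k M :: nat
  assumes "k \<ge> 1"
    and "uniform_hypergraph k M I"
  shows "\<exists>D::nat. AE \<phi> in random_qsat M I. vec.dim (ker_op (hamiltonian M I \<phi>)) = D"
proof -
  let ?N = "\<lambda>m. haar_sphere (qubit_basis (I m))"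
  let ?dim = "\<lambda>\<phi>. vec.dim (ker_op (hamiltonian M I \<phi>))"
  interpret product_sigma_finite ?N
    by (intro product_sigma_finite.intro prob_space_imp_sigma_finite prob_space_haar_sphere) simp
  have space: "space (random_qsat M I) = (\<Pi>\<^sub>E m\<in>{1..M}. qubit_basis (I m) \<rightarrow>\<^sub>E UNIV)"
    by (simp add: random_qsat_def space_PiM space_haar_sphere)
  then have "space (random_qsat M I) \<noteq> {}"
    by (simp add: PiE_eq_empty_iff)
  \<comment> \<open>The minimum runs over the whole carrier of the product measure, which also
    contains states that are not unit vectors.\<close>
  then obtain \<phi>0 where \<phi>0: "\<phi>0 \<in> space (random_qsat M I)"
      and min: "\<And>\<phi>. \<phi> \<in> space (random_qsat M I) \<Longrightarrow> ?dim \<phi>0 \<le> ?dim \<phi>"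
    using ex_has_least_nat[of "\<lambda>\<phi>. \<phi> \<in> space (random_qsat M I)" _ ?dim] by blast
  obtain B where B: "vec.independent B" "ker_op (hamiltonian M I \<phi>0) \<subseteq> vec.span B" "card B = ?dim \<phi>0"
    using vec.basis_exists by metis
  have fin: "finite B" by (rule vec.finiteI_independent[OF B(1)])
  have "AE \<phi> in random_qsat M I. det (hamiltonian M I \<phi> + gram B) \<noteq> 0"
    unfolding random_qsat_def
  \<comment> \<open>The same resampling principle, now with whole edge states as coordinates and
    \<phi>0 as the starting point.\<close>
  proof (rule AE_PiM_of_AE_fun_upd)
    have "(\<lambda>\<phi>. \<phi> m b) \<in> borel_measurable (PiM {1..M} ?N)"
      if "m \<in> {1..M}" "b \<in> qubit_basis (I m)" for m b
    proof -
      have "(\<lambda>\<psi>. \<psi> b) \<in> borel_measurable (?N m)"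
        using that(2) by measurable
      then show ?thesis
        using measurable_compose[OF measurable_component_singleton[OF that(1), of ?N]] by blast
    qed
    then have [measurable]: "(\<lambda>\<phi>. det (hamiltonian M I \<phi> + gram B)) \<in> borel_measurable (PiM {1..M} ?N)"
      unfolding mixed_ham_same[symmetric] by (intro borel_measurable_det_mixed_ham) auto
    show "{\<phi> \<in> space (PiM {1..M} ?N). det (hamiltonian M I \<phi> + gram B) \<noteq> 0} \<in> sets (PiM {1..M} ?N)"
      by measurable
    show "\<phi>0 \<in> space (PiM {1..M} ?N)"
      using \<phi>0 by (simp add: random_qsat_def)
    show "det (hamiltonian M I \<phi>0 + gram B) \<noteq> 0"
      by (rule det_hamiltonian_add_gram_nz[OF fin B(2)])
    show "AE \<psi> in ?N m. det (hamiltonian M I (\<phi>(m := \<psi>)) + gram B) \<noteq> 0"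
      if "\<phi> \<in> space (PiM {1..M} ?N)" "m \<in> {1..M}" "det (hamiltonian M I \<phi> + gram B) \<noteq> 0" for \<phi> m
      using that by (intro AE_haar_sphere_det_nz fin) (auto simp: space_PiM space_haar_sphere)
  qed simp
  then have "AE \<phi> in random_qsat M I. ?dim \<phi> = ?dim \<phi>0"
    using AE_space
  proof eventually_elim
    case (elim \<phi>)
    \<comment> \<open>Invertibility bounds the dimension above by \<open>card B\<close>; minimality
      of \<phi>0 bounds it below by the same number.\<close>
    then show ?case
      using dim_ker_le_card_gram[OF fin elim(1)] min[OF elim(2)] B(3) by simp
  qed
  then show ?thesis by blast
qed

end
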